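(* Let $X$ be a locally compact Hausdorff space such that any nonempty open set in $X$ contains a (nonempty) compact connected subset that is not a singleton. Then $p\mathbf{DTM}(X)$ is dense in $\mathbf{DTM}(X)$.
   Context: $\mathcal{O}(X)$, $\mathcal{C}(X)$, $\mathcal{K}(X)$ are the collections of open, closed, compact subsets of $X$. A deficient topological measure on $X$ is a set function $\nu:\mathcal{C}(X)\cup\mathcal{O}(X)\to[0,\infty]$, not identically $\infty$, such that: (DTM1) $\nu(C\sqcup K)=\nu(C)+\nu(K)$ for disjoint $C,K\in\mathcal{K}(X)$; (DTM2) $\nu(U)=\sup\{\nu(C): C\subseteq U,\ C\in\mathcal{K}(X)\}$ for $U\in\mathcal{O}(X)$; (DTM3) $\nu(F)=\inf\{\nu(U): F\subseteq U,\ U\in\mathcal{O}(X)\}$ for $F\in\mathcal{C}(X)$. $\mathbf{DTM}(X)$ is the set of finite ($\nu(X)<\infty$) deficient topological measures. A deficient topological measure $\nu$ is proper if $m\le\nu$ (on $\mathcal{O}(X)\cup\mathcal{C}(X)$) with $m$ a Radon measure implies $m=0$; here a Radon measure is a Borel measure finite on compact sets, outer regular on all Borel sets and inner regular (by compact sets) on open sets. $p\mathbf{DTM}(X)$ is the set of proper elements of $\mathbf{DTM}(X)$. $\mathbf{DTM}(X)$ carries the weak topology: the coarsest topology making $\mu\mapsto\int_X f\,d\mu$ continuous for every $f\in C_0^+(X)$ (nonnegative continuous functions vanishing at infinity), where $\int_X f\,d\mu=\int_0^b\mu(f^{-1}((t,\infty)))\,dt$ if $f(X)\subseteq[0,b]$.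 "$Y$ is dense in $Z$" means $Z\subseteq\overline{Y}$. *)

theory Defs
  imports "HOL-Analysis.Analysis"
begin

text \<open>The space is the carrier of a type of class \<open>t2_space\<close>. A set function on the open and closed
  sets is a function on all sets that is \<open>extensional\<close>, i.e. it carries no information outside
  that domain.\<close>

definition open_closed_sets :: "'a::topological_space set set" where
  "open_closed_sets = {A. open A \<or> closed A}"

definition deficient_topological_measure :: "('a::t2_space set \<Rightarrow> ennreal) \<Rightarrow> bool" where
  "deficient_topological_measure \<nu> \<longleftrightarrow>
     \<nu> \<in> extensional open_closed_sets \<and>
     (\<exists>A\<in>open_closed_sets. \<nu> A \<noteq> \<infinity>) \<and>
     (\<forall>C K. compact C \<longrightarrow> compact K \<longrightarrow> C \<inter> K = {} \<longrightarrow> \<nu> (C \<union> K) = \<nu> C + \<nu> K) \<and>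
     (\<forall>U. open U \<longrightarrow> \<nu> U = (SUP C\<in>{C. compact C \<and> C \<subseteq> U}. \<nu> C)) \<and>
     (\<forall>F. closed F \<longrightarrow> \<nu> F = (INF U\<in>{U. open U \<and> F \<subseteq> U}. \<nu> U))"

definition DTM :: "('a::t2_space set \<Rightarrow> ennreal) set" where
  "DTM = {\<nu>. deficient_topological_measure \<nu> \<and> \<nu> UNIV < \<infinity>}"

definition radon_measure :: "'a::t2_space measure \<Rightarrow> bool" where
  "radon_measure m \<longleftrightarrow>
     sets m = sets borel \<and>
     (\<forall>K. compact K \<longrightarrow> emeasure m K < \<infinity>) \<and>
     (\<forall>A\<in>sets borel. emeasure m A = (INF U\<in>{U. open U \<and> A \<subseteq> U}. emeasure m U)) \<and>
     (\<forall>U. open U \<longrightarrow> emeasure m U = (SUP K\<in>{K. compact K \<and> K \<subseteq> U}. emeasure m K))"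

definition proper_dtm :: "('a::t2_space set \<Rightarrow> ennreal) \<Rightarrow> bool" where
  "proper_dtm \<nu> \<longleftrightarrow>
     deficient_topological_measure \<nu> \<and>
     (\<forall>m. radon_measure m \<longrightarrow> (\<forall>A\<in>open_closed_sets. emeasure m A \<le> \<nu> A) \<longrightarrow> m = null_measure borel)"

definition pDTM :: "('a::t2_space set \<Rightarrow> ennreal) set" where
  "pDTM = {\<nu>\<in>DTM. proper_dtm \<nu>}"

definition C0_plus :: "('a::topological_space \<Rightarrow> real) set" where
  "C0_plus = {f. continuous_on UNIV f \<and> (\<forall>x. 0 \<le> f x) \<and>
                 (\<forall>e>0. \<exists>K. compact K \<and> (\<forall>x. x \<notin> K \<longrightarrow> \<bar>f x\<bar> < e))}"

text \<open>For set functions of finite total mass the integrand is finite and, by \<open>dtm_integral_eq\<close> below,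
  the value does not depend on the bound that is chosen.\<close>

definition dtm_integral :: "('a::topological_space set \<Rightarrow> ennreal) \<Rightarrow> ('a \<Rightarrow> real) \<Rightarrow> real" where
  "dtm_integral \<mu> f =
     (let b = (SOME b. range f \<subseteq> {0..b}) in integral {0..b} (\<lambda>t. enn2real (\<mu> (f -` {t<..}))))"

definition weak_topology :: "('a::t2_space set \<Rightarrow> ennreal) topology" where
  "weak_topology =
     topology_generated_by {{\<mu>\<in>DTM. dtm_integral \<mu> f \<in> V} | f V. f \<in> C0_plus \<and> open V}"

lemma dtm_empty:
  assumes "\<nu> \<in> DTM"
  shows "\<nu> {} = 0"
proof -
  have d: "deficient_topological_measure \<nu>" and fin: "\<nu> UNIV < \<infinity>"
    using assms by (auto simp: DTM_def)
  have "\<nu> UNIV = (SUP C\<in>{C. compact C \<and> C \<subseteq> UNIV}. \<nu> C)"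
    using d unfolding deficient_topological_measure_def by (metis open_UNIV)
  then have "\<nu> {} \<le> \<nu> UNIV" by (auto intro: SUP_upper)
  then have f: "\<nu> {} < \<infinity>" using fin by auto
  have "\<nu> {} = \<nu> {} + \<nu> {}"
    using d unfolding deficient_topological_measure_def by (metis Int_empty_left Un_empty compact_empty)
  then have "\<nu> {} + \<nu> {} = \<nu> {} + 0" by simp
  then show ?thesis using f by (subst (asm) ennreal_add_left_cancel) auto
qed

lemma C0_plus_bounded:
  assumes "f \<in> C0_plus"
  shows "\<exists>b. range f \<subseteq> {0..b}"
proof -
  obtain K where K: "compact K" "\<And>x. x \<notin> K \<Longrightarrow> \<bar>f x\<bar> < 1"
    using assms unfolding C0_plus_def by (auto dest!: spec[of _ 1])
  have "compact (f ` K)"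
    using assms K by (auto simp: C0_plus_def intro: compact_continuous_image continuous_on_subset)
  then obtain B where B: "\<And>x. x \<in> K \<Longrightarrow> \<bar>f x\<bar> \<le> B"
    by (metis bounded_real compact_imp_bounded imageI)
  have "f x \<le> max 1 B" for x
    using K(2)[of x] B[of x] by (cases "x \<in> K") auto
  then show ?thesis using assms by (force simp: C0_plus_def)
qed

lemma dtm_integral_eq:
  assumes "\<mu> \<in> DTM" and b: "range f \<subseteq> {0..b}"
  shows "dtm_integral \<mu> f = integral {0..b} (\<lambda>t. enn2real (\<mu> (f -` {t<..})))"
proof -
  let ?g = "\<lambda>t. enn2real (\<mu> (f -` {t<..}))"
  have z: "?g t = 0" if "range f \<subseteq> {0..c}" "c \<le> t" for c t
  proof -
    have "f x \<le> c" for x using subsetD[OF that(1), of "f x"] by simp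
    then have "\<not> t < f x" for x using that(2) by (meson not_less order_trans)
    then have "f -` {t<..} = {}" by auto
    then show ?thesis using dtm_empty[OF assms(1)] by simp
  qed
  have eq: "integral {0..d} ?g = integral {0..c} ?g"
    if "range f \<subseteq> {0..c}" "c \<le> d" for c d :: real
  proof -
    have "integral {0..c} ?g = integral {0..d} (\<lambda>t. if t \<in> {0..c} then ?g t else 0)"
      using that(2) by (subst Henstock_Kurzweil_Integration.integral_restrict_Int) (simp add: Int_absorb2)
    also have "\<dots> = integral {0..d} ?g"
      by (rule Henstock_Kurzweil_Integration.integral_cong) (use z[OF that(1)] in auto)
    finally show ?thesis by simp
  qed
  define c where "c = (SOME b. range f \<subseteq> {0..b})"
  have c: "range f \<subseteq> {0..c}" unfolding c_def by (rule someI[of _ b]) (rule b)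
  have "integral {0..c} ?g = integral {0..b} ?g"
    using eq[OF c, of b] eq[OF b, of c] by (cases "c \<le> b") auto
  then show ?thesis by (simp add: dtm_integral_def Let_def c_def)
qed

lemma topspace_weak_topology: "topspace weak_topology = DTM"
proof -
  have "(\<lambda>_. 0) \<in> C0_plus" by (auto simp: C0_plus_def intro: exI[of _ "{}"])
  then show ?thesis unfolding weak_topology_def by (auto intro!: exI[of _ "DTM"] exI[of _ UNIV])
qed

lemma continuous_map_weak_topology:
  assumes "f \<in> C0_plus"
  shows "continuous_map weak_topology euclideanreal (\<lambda>\<mu>. dtm_integral \<mu> f)"
  unfolding continuous_map_def topspace_weak_topology
proof (intro conjI allI impI)
  fix V :: "real set"
  assume "openin euclideanreal V"
  then show "openin weak_topology {\<mu>\<in>DTM. dtm_integral \<mu> f \<in> V}"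
    unfolding weak_topology_def using assms by (intro topology_generated_by_Basis) auto
qed auto

lemma weak_topology_coarsest:
  assumes "topspace T = DTM"
    and "\<And>f. f \<in> C0_plus \<Longrightarrow> continuous_map T euclideanreal (\<lambda>\<mu>. dtm_integral \<mu> f)"
    and "openin weak_topology W"
  shows "openin T W"
proof -
  have "generate_topology_on {{\<mu>\<in>DTM. dtm_integral \<mu> f \<in> V} | f V. f \<in> C0_plus \<and> open V} W"
    using assms(3) by (simp add: weak_topology_def openin_topology_generated_by_iff)
  then show ?thesis
  proof induction
    case (Basis s)
    then obtain f V where "s = {\<mu>\<in>DTM. dtm_integral \<mu> f \<in> V}" "f \<in> C0_plus" "open V" by auto
    then show ?case
      using assms(2)[of f] unfolding continuous_map_def assms(1) by auto
  qed auto
qed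

end

theory Submission
  imports Defs
begin

text \<open>Every finite deficient topological measure \<open>\<nu>\<close> splits as \<open>\<nu> = q + M\<close> with \<open>q\<close> proper and
  \<open>M\<close> a Radon measure (\<open>radon_proper_decomposition\<close>), so it is enough to approximate \<open>M\<close> by
  something that stays proper when it is added to \<open>q\<close>. A measure is approximated weakly by finite
  combinations of point masses. A point mass is not proper, but it may be replaced by the set
  function that gives mass \<open>a\<close> to exactly those sets that contain a fixed compact connected set \<open>D\<close>
  near the point: connectedness of \<open>D\<close> makes it additive on disjoint compact sets, and as soon as
  \<open>D\<close> has two points no nonzero measure lies below it, since such a measure would vanish on the
  complement of each point of \<open>D\<close>. The same argument shows that adding such a function to a proper
  one gives a proper one (\<open>pDTM_add_connected_atom\<close>). The hypothesis on the space provides the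
  sets \<open>D\<close>.

  For the approximation only finitely many test functions \<open>f\<close> matter
  (\<open>weak_topology_neighbourhood\<close>). They are bounded, so the space is partitioned into finitely many
  Borel cells on which all of them are nearly constant (\<open>bounded_functions_cells\<close>); the \<open>M\<close>-mass of
  each cell is moved to a connected set near one of its points. No value of \<open>f\<close> is moved by \<open>2 * d\<close>
  or more, so the mass of a superlevel set \<open>{f > t + 2 * d}\<close> under one of the two set functions is at most
  the mass of \<open>{f > t}\<close> under the other. As the integral is the integral of these masses over \<open>t\<close>,
  the integrals differ by at most \<open>2 * d\<close> times the total mass (\<open>dtm_integral_le_shift\<close>).

  The decomposition is obtained by exhaustion: Radon measures \<open>m\<^sub>0, m\<^sub>1, \<dots>\<close> are chosen so that
  their partial sums remain below \<open>\<nu>\<close> and each has at least half of the total mass still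
  possible. Their sum \<open>M\<close> is Radon, \<open>\<nu> - M\<close> is again a deficient topological measure
  (\<open>DTM_diff_radon\<close>), and a Radon measure below \<open>\<nu> - M\<close> has at most twice the mass of every \<open>m\<^sub>k\<close>,
  hence mass 0 because the masses of the \<open>m\<^sub>k\<close> are summable.\<close>

section \<open>Deficient topological measures\<close>

lemma DTM_compact_Un:
  assumes "\<nu> \<in> DTM" "compact C" "compact K" "C \<inter> K = {}"
  shows "\<nu> (C \<union> K) = \<nu> C + \<nu> K"
  using assms unfolding DTM_def deficient_topological_measure_def by blast

lemma DTM_open_SUP:
  assumes "\<nu> \<in> DTM" "open U"
  shows "\<nu> U = (SUP C\<in>{C. compact C \<and> C \<subseteq> U}. \<nu> C)"
  using assms unfolding DTM_def deficient_topological_measure_def by blast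

lemma DTM_closed_INF:
  assumes "\<nu> \<in> DTM" "closed F"
  shows "\<nu> F = (INF U\<in>{U. open U \<and> F \<subseteq> U}. \<nu> U)"
  using assms unfolding DTM_def deficient_topological_measure_def by blast

lemma DTM_finite: "\<nu> \<in> DTM \<Longrightarrow> \<nu> UNIV < \<infinity>"
  by (simp add: DTM_def)

lemma open_closed_setsI: "open A \<Longrightarrow> A \<in> open_closed_sets" "closed A \<Longrightarrow> A \<in> open_closed_sets"
  "compact (A :: 'a::t2_space set) \<Longrightarrow> A \<in> open_closed_sets"
  by (auto simp: open_closed_sets_def compact_imp_closed)

lemma open_closed_sets_borel: "A \<in> open_closed_sets \<Longrightarrow> A \<in> sets borel"
  by (auto simp: open_closed_sets_def)

text \<open>Given monotonicity, one inequality in each of the two regularity conditions is trivial. Compact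
  sets are closed, so the single monotonicity assumption serves both conditions.\<close>

lemma DTM_restrictI:
  fixes h :: "'a::t2_space set \<Rightarrow> ennreal"
  assumes add: "\<And>C K. compact C \<Longrightarrow> compact K \<Longrightarrow> C \<inter> K = {} \<Longrightarrow> h (C \<union> K) = h C + h K"
    and mono: "\<And>F U. closed F \<Longrightarrow> open U \<Longrightarrow> F \<subseteq> U \<Longrightarrow> h F \<le> h U"
    and inner: "\<And>U. open U \<Longrightarrow> h U \<le> (SUP C\<in>{C. compact C \<and> C \<subseteq> U}. h C)"
    and outer: "\<And>F. closed F \<Longrightarrow> (INF U\<in>{U. open U \<and> F \<subseteq> U}. h U) \<le> h F"
    and fin: "h UNIV < \<infinity>"
  shows "restrict h open_closed_sets \<in> DTM"
proof -
  have "h U = (SUP C\<in>{C. compact C \<and> C \<subseteq> U}. h C)" if "open U" for U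
    using that by (intro antisym inner SUP_least) (auto intro: mono compact_imp_closed)
  moreover have "h F = (INF U\<in>{U. open U \<and> F \<subseteq> U}. h U)" if "closed F" for F
    using that by (intro antisym outer INF_greatest) (auto intro: mono)
  moreover have "\<exists>A\<in>open_closed_sets. h A \<noteq> \<infinity>"
    using fin by (intro bexI[of _ UNIV]) (auto simp: open_closed_sets_def)
  moreover have "(SUP C\<in>{C. compact C \<and> C \<subseteq> U}. restrict h open_closed_sets C) =
      (SUP C\<in>{C. compact C \<and> C \<subseteq> U}. h C)" for U
    by (intro SUP_cong) (auto simp: open_closed_setsI)
  moreover have "(INF U\<in>{U. open U \<and> F \<subseteq> U}. restrict h open_closed_sets U) =
      (INF U\<in>{U. open U \<and> F \<subseteq> U}. h U)" for F
    by (intro INF_cong) (auto simp: open_closed_setsI)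
  ultimately show ?thesis
    using add fin unfolding DTM_def deficient_topological_measure_def
    by (simp add: open_closed_setsI compact_Un)
qed

lemma DTM_mono:
  fixes \<nu> :: "'a::t2_space set \<Rightarrow> ennreal"
  assumes \<nu>: "\<nu> \<in> DTM" and A: "A \<in> open_closed_sets" and B: "B \<in> open_closed_sets" and "A \<subseteq> B"
  shows "\<nu> A \<le> \<nu> B"
proof -
  have op: "\<nu> A' \<le> \<nu> U" if "A' \<in> open_closed_sets" "open U" "A' \<subseteq> U" for A' U
  proof (cases "open A'")
    case True
    then show ?thesis
      unfolding DTM_open_SUP[OF \<nu> True] DTM_open_SUP[OF \<nu> \<open>open U\<close>]
      using that by (intro SUP_subset_mono) auto
  next
    case False
    then have "closed A'" using that by (auto simp: open_closed_sets_def)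
    then show ?thesis
      unfolding DTM_closed_INF[OF \<nu> \<open>closed A'\<close>] using that by (intro INF_lower) auto
  qed
  show ?thesis
  proof (cases "open B")
    case True
    then show ?thesis using op A \<open>A \<subseteq> B\<close> by blast
  next
    case False
    then have "closed B" using B by (auto simp: open_closed_sets_def)
    then show ?thesis
      unfolding DTM_closed_INF[OF \<nu> \<open>closed B\<close>] using A \<open>A \<subseteq> B\<close>
      by (intro INF_greatest op) auto
  qed
qed

lemma DTM_less_top:
  assumes "\<nu> \<in> DTM" "A \<in> open_closed_sets"
  shows "\<nu> A < \<infinity>"
  using DTM_mono[of \<nu> A UNIV] DTM_finite[of \<nu>] assms
  by (auto simp: open_closed_sets_def intro: le_less_trans)

text \<open>The closed set \<open>F\<close> lies in the open set \<open>U - K\<close>, whose value is approximated by its compact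
  subsets; additivity on disjoint compact sets applies to each of these and \<open>K\<close>.\<close>

lemma DTM_superadditive:
  fixes \<nu> :: "'a::t2_space set \<Rightarrow> ennreal"
  assumes \<nu>: "\<nu> \<in> DTM" and "closed F" "compact K" "open U" "F \<union> K \<subseteq> U" "F \<inter> K = {}"
  shows "\<nu> F + \<nu> K \<le> \<nu> U"
proof -
  have o: "open (U - K)" using assms by (simp add: compact_imp_closed open_Diff)
  have "\<nu> F + \<nu> K \<le> \<nu> (U - K) + \<nu> K"
    using assms o compact_imp_closed[of K]
    by (intro add_mono DTM_mono) (auto simp: open_closed_sets_def)
  also have "\<dots> = (SUP C\<in>{C. compact C \<and> C \<subseteq> U - K}. \<nu> C + \<nu> K)"
    unfolding DTM_open_SUP[OF \<nu> o]
    by (rule ennreal_SUP_add_left[symmetric]) (auto intro: exI[of _ "{}"])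
  also have "\<dots> \<le> \<nu> U"
  proof (rule SUP_least)
    fix C assume C: "C \<in> {C. compact C \<and> C \<subseteq> U - K}"
    then have "\<nu> C + \<nu> K = \<nu> (C \<union> K)"
      using assms by (intro DTM_compact_Un[symmetric]) auto
    also have "\<dots> \<le> \<nu> U"
      using C assms by (intro DTM_mono open_closed_setsI(3) open_closed_setsI(1) compact_Un) auto
    finally show "\<nu> C + \<nu> K \<le> \<nu> U" .
  qed
  finally show ?thesis .
qed

section \<open>Finite Radon measures\<close>

lemma less_add_ennreal: "x < \<infinity> \<Longrightarrow> 0 < e \<Longrightarrow> x < x + ennreal e"
  using ennreal_add_left_cancel_le[of x "ennreal e" 0] by (auto simp: not_le[symmetric])

text \<open>For finite measures regularity can be stated through differences of sets. In this form it passes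
  to smaller measures and to sums.\<close>

lemma radon_measure_finite_iff:
  fixes m :: "'a::t2_space measure"
  assumes s[measurable_cong]: "sets m = sets borel" and fin: "emeasure m UNIV < \<infinity>"
  shows "radon_measure m \<longleftrightarrow>
    (\<forall>A\<in>sets borel. \<forall>e>0. \<exists>U. open U \<and> A \<subseteq> U \<and> emeasure m (U - A) \<le> ennreal e) \<and>
    (\<forall>U. open U \<longrightarrow> (\<forall>e>0. \<exists>K. compact K \<and> K \<subseteq> U \<and> emeasure m (U - K) \<le> ennreal e))"
    (is "_ \<longleftrightarrow> ?O \<and> ?I")
proof -
  have f: "emeasure m A < \<infinity>" for A
    using emeasure_space[of m A] sets_eq_imp_space_eq[OF s] fin by (auto intro: le_less_trans)
  have split: "emeasure m B = emeasure m A + emeasure m (B - A)"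
    if "A \<in> sets borel" "B \<in> sets borel" "A \<subseteq> B" for A B
    using that s by (subst plus_emeasure) (auto simp: Un_absorb1)
  have lt: "emeasure m A < emeasure m A + ennreal e" if "e > 0" for A e
    using less_add_ennreal f that .
  have "?O \<and> ?I" if R: "radon_measure m"
  proof -
    have Ro: "emeasure m A = (INF U\<in>{U. open U \<and> A \<subseteq> U}. emeasure m U)" if "A \<in> sets borel" for A
      using R that unfolding radon_measure_def by blast
    have Ri: "emeasure m U = (SUP K\<in>{K. compact K \<and> K \<subseteq> U}. emeasure m K)" if "open U" for U
      using R that unfolding radon_measure_def by blast
    have ?O
    proof (intro ballI allI impI)
      fix A :: "'a set" and e :: real assume A: "A \<in> sets borel" and "e > 0"
      have "(INF U\<in>{U. open U \<and> A \<subseteq> U}. emeasure m U) < emeasure m A + ennreal e"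
        using Ro[OF A] lt[OF \<open>e > 0\<close>, of A] by metis
      then obtain U where U: "open U" "A \<subseteq> U" "emeasure m U < emeasure m A + ennreal e"
        unfolding INF_less_iff by auto
      then have "emeasure m A + emeasure m (U - A) < emeasure m A + ennreal e"
        using split[of A U] A by auto
      then have "emeasure m (U - A) \<le> ennreal e"
        using ennreal_add_left_cancel_le[of "emeasure m A" "emeasure m (U - A)" "ennreal e"] f[of A] by auto
      then show "\<exists>U. open U \<and> A \<subseteq> U \<and> emeasure m (U - A) \<le> ennreal e" using U by auto
    qed
    moreover have ?I
    proof (intro allI impI)
      fix U :: "'a set" and e :: real assume U: "open U" and "e > 0"
      have "emeasure m U < (SUP K\<in>{K. compact K \<and> K \<subseteq> U}. emeasure m K) + ennreal e"
        using Ri[OF U] lt[OF \<open>e > 0\<close>, of U] by metis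
      also have "\<dots> = (SUP K\<in>{K. compact K \<and> K \<subseteq> U}. emeasure m K + ennreal e)"
        by (rule ennreal_SUP_add_left[symmetric]) (auto intro: exI[of _ "{}"])
      finally obtain K where K: "compact K" "K \<subseteq> U" "emeasure m U < emeasure m K + ennreal e"
        unfolding less_SUP_iff by auto
      then have "emeasure m K + emeasure m (U - K) < emeasure m K + ennreal e"
        using split[of K U] U compact_imp_closed[OF K(1)] by auto
      then have "emeasure m (U - K) \<le> ennreal e"
        using ennreal_add_left_cancel_le[of "emeasure m K" "emeasure m (U - K)" "ennreal e"] f[of K] by auto
      then show "\<exists>K. compact K \<and> K \<subseteq> U \<and> emeasure m (U - K) \<le> ennreal e" using K by auto
    qed
    ultimately show ?thesis by blast
  qed
  moreover have "radon_measure m" if R: "?O \<and> ?I"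
  proof -
    have "emeasure m A = (INF U\<in>{U. open U \<and> A \<subseteq> U}. emeasure m U)" if A: "A \<in> sets borel" for A
    proof (rule antisym)
      show "emeasure m A \<le> (INF U\<in>{U. open U \<and> A \<subseteq> U}. emeasure m U)"
        by (rule INF_greatest, rule emeasure_mono) (use s in simp_all)
      show "(INF U\<in>{U. open U \<and> A \<subseteq> U}. emeasure m U) \<le> emeasure m A"
      proof (rule ennreal_le_epsilon)
        fix e :: real assume "e > 0"
        then obtain U where U: "open U" "A \<subseteq> U" "emeasure m (U - A) \<le> ennreal e"
          using conjunct1[OF R, rule_format, OF A] by blast
        then show "(INF U\<in>{U. open U \<and> A \<subseteq> U}. emeasure m U) \<le> emeasure m A + ennreal e"
          using split[of A U] A by (intro INF_lower2[of U]) (auto intro: add_mono)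
      qed
    qed
    moreover have "emeasure m U = (SUP K\<in>{K. compact K \<and> K \<subseteq> U}. emeasure m K)" if U: "open U" for U
    proof (rule antisym)
      show "(SUP K\<in>{K. compact K \<and> K \<subseteq> U}. emeasure m K) \<le> emeasure m U"
        by (rule SUP_least, rule emeasure_mono) (use U s in simp_all)
      show "emeasure m U \<le> (SUP K\<in>{K. compact K \<and> K \<subseteq> U}. emeasure m K)"
      proof (rule ennreal_le_epsilon)
        fix e :: real assume "e > 0"
        then obtain K where K: "compact K" "K \<subseteq> U" "emeasure m (U - K) \<le> ennreal e"
          using conjunct2[OF R, rule_format, OF U] by blast
        then have "emeasure m U \<le> emeasure m K + ennreal e"
          using split[of K U] U compact_imp_closed[OF K(1)] by (auto intro: add_mono)
        also have "\<dots> \<le> (SUP K\<in>{K. compact K \<and> K \<subseteq> U}. emeasure m K) + ennreal e"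
          using K by (intro add_mono SUP_upper) auto
        finally show "emeasure m U \<le> (SUP K\<in>{K. compact K \<and> K \<subseteq> U}. emeasure m K) + ennreal e" .
      qed
    qed
    ultimately show ?thesis using s f unfolding radon_measure_def by (intro conjI ballI allI impI)
  qed
  ultimately show ?thesis by (rule iffI)
qed

lemma radon_measure_dominated:
  fixes m n :: "'a::t2_space measure"
  assumes "radon_measure m" "emeasure m UNIV < \<infinity>" and s: "sets n = sets borel"
    and le: "\<And>A. A \<in> sets borel \<Longrightarrow> emeasure n A \<le> emeasure m A"
  shows "radon_measure n"
proof -
  have sm: "sets m = sets borel" using assms by (simp add: radon_measure_def)
  have fn: "emeasure n UNIV < \<infinity>" using le[of UNIV] assms(2) by (simp add: le_less_trans)
  have "emeasure n (U - A) \<le> e" if "emeasure m (U - A) \<le> e" "U \<in> sets borel" "A \<in> sets borel" for U A e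
    using le[of "U - A"] that by auto
  moreover have "K \<in> sets borel" if "compact K" for K :: "'a set"
    using that by (simp add: compact_imp_closed)
  ultimately show ?thesis
    using assms(1) unfolding radon_measure_finite_iff[OF sm assms(2)] radon_measure_finite_iff[OF s fn]
    by (metis borel_open)
qed

definition sum_measure :: "(nat \<Rightarrow> 'a::topological_space measure) \<Rightarrow> 'a measure" where
  "sum_measure m = measure_of UNIV (sets borel) (\<lambda>A. \<Sum>k. emeasure (m k) A)"

lemma sets_sum_measure: "sets (sum_measure m) = sets borel"
  using sets.sigma_sets_eq[of borel] by (simp add: sum_measure_def)

lemma emeasure_sum_measure:
  assumes s: "\<And>k. sets (m k) = sets borel" and A: "A \<in> sets borel"
  shows "emeasure (sum_measure m) A = (\<Sum>k. emeasure (m k) A)"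
  unfolding sum_measure_def
proof (rule emeasure_measure_of_sigma)
  show "sigma_algebra UNIV (sets (borel :: 'a measure))"
    using sets.sigma_algebra_axioms[of "borel :: 'a measure"] by simp
  show "positive (sets borel) (\<lambda>A. \<Sum>k. emeasure (m k) A)"
    by (simp add: positive_def)
  show "countably_additive (sets borel) (\<lambda>A. \<Sum>k. emeasure (m k) A)"
  proof (rule countably_additiveI)
    fix A :: "nat \<Rightarrow> 'a set"
    assume A: "range A \<subseteq> sets borel" "disjoint_family A"
    have "(\<Sum>i. \<Sum>k. emeasure (m k) (A i)) = (\<Sum>i. \<integral>\<^sup>+k. emeasure (m k) (A i) \<partial>count_space UNIV)"
      by (simp add: nn_integral_count_space_nat)
    also have "\<dots> = (\<integral>\<^sup>+k. (\<Sum>i. emeasure (m k) (A i)) \<partial>count_space UNIV)"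
      by (rule nn_integral_suminf[symmetric]) auto
    also have "\<dots> = (\<Sum>k. \<Sum>i. emeasure (m k) (A i))"
      by (simp add: nn_integral_count_space_nat)
    also have "\<dots> = (\<Sum>k. emeasure (m k) (\<Union>i. A i))"
      using A s by (simp add: suminf_emeasure)
    finally show "(\<Sum>i. \<Sum>k. emeasure (m k) (A i)) = (\<Sum>k. emeasure (m k) (\<Union>i. A i))" .
  qed
qed (use A in auto)

lemma radon_sum_measure:
  fixes m :: "nat \<Rightarrow> 'a::t2_space measure"
  assumes R: "\<And>k. radon_measure (m k)" and fin: "(\<Sum>k. emeasure (m k) UNIV) < \<infinity>"
  shows "radon_measure (sum_measure m)"
proof -
  have s: "sets (m k) = sets borel" for k using R by (simp add: radon_measure_def)
  have em: "emeasure (sum_measure m) A = (\<Sum>k. emeasure (m k) A)" if "A \<in> sets borel" for A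
    using emeasure_sum_measure s that by blast
  have fk: "emeasure (m k) UNIV < \<infinity>" for k
    using ennreal_suminf_lessD[OF fin] .
  have mono: "emeasure (m k) A \<le> emeasure (m k) B" if "A \<subseteq> B" "B \<in> sets borel" for A B k
    using that s by (auto intro: emeasure_mono)
  \<comment> \<open>Regularity of finitely many summands is combined by a finite intersection or union; the mass of
    the remaining summands is small on the whole space. The case \<open>n = 0\<close> is excluded because \<open>n\<close>
    is a denominator in \<open>small\<close>.\<close>
  have tail: "\<exists>n>0. (\<Sum>k. emeasure (m (k + n)) UNIV) \<le> ennreal e" if "e > 0" for e
  proof -
    let ?S = "\<Sum>k. emeasure (m k) UNIV"
    have "?S < ?S + ennreal e"
      using less_add_ennreal[OF fin that] .
    also have "\<dots> = (SUP n. (\<Sum>k<n. emeasure (m k) UNIV) + ennreal e)"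
      unfolding suminf_eq_SUP by (rule ennreal_SUP_add_left[symmetric]) auto
    finally obtain n where n: "?S < (\<Sum>k<n. emeasure (m k) UNIV) + ennreal e"
      unfolding less_SUP_iff by auto
    also have "\<dots> \<le> (\<Sum>k<Suc n. emeasure (m k) UNIV) + ennreal e"
      by (intro add_mono sum_mono2) auto
    finally have n': "?S < (\<Sum>k<Suc n. emeasure (m k) UNIV) + ennreal e" .
    have "?S = (\<Sum>k. emeasure (m (k + Suc n)) UNIV) + (\<Sum>k<Suc n. emeasure (m k) UNIV)"
      by (rule suminf_offset) auto
    moreover have "(\<Sum>k<Suc n. emeasure (m k) UNIV) < top"
      using fk by (simp del: sum.lessThan_Suc)
    ultimately have "(\<Sum>k. emeasure (m (k + Suc n)) UNIV) \<le> ennreal e"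
      using n' ennreal_add_left_cancel_le[of "\<Sum>k<Suc n. emeasure (m k) UNIV" "\<Sum>k. emeasure (m (k + Suc n)) UNIV" "ennreal e"]
      by (auto simp: add.commute simp del: sum.lessThan_Suc)
    then show ?thesis by blast
  qed
  have small: "emeasure (sum_measure m) B \<le> ennreal e"
    if n: "n > 0" "(\<Sum>k. emeasure (m (k + n)) UNIV) \<le> ennreal (e / 2)" and "e > 0"
      and B: "B \<in> sets borel" "\<And>k. k < n \<Longrightarrow> emeasure (m k) B \<le> ennreal (e / (2 * n))" for n e B
  proof -
    have "emeasure (sum_measure m) B = (\<Sum>k. emeasure (m (k + n)) B) + (\<Sum>k<n. emeasure (m k) B)"
      unfolding em[OF B(1)] by (rule suminf_offset) auto
    also have "\<dots> \<le> (\<Sum>k. emeasure (m (k + n)) UNIV) + (\<Sum>k<n. ennreal (e / (2 * n)))"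
      using B(2) by (intro add_mono suminf_le sum_mono mono) auto
    also have "\<dots> \<le> ennreal (e / 2) + ennreal (e / 2)"
      using n \<open>e > 0\<close> by (intro add_mono) (auto simp: ennreal_of_nat_eq_real_of_nat ennreal_mult[symmetric])
    also have "\<dots> = ennreal e" using \<open>e > 0\<close> by (simp add: ennreal_plus[symmetric] del: ennreal_plus)
    finally show ?thesis .
  qed
  have fin': "emeasure (sum_measure m) UNIV < \<infinity>" using em[of UNIV] fin by simp
  note reg = R[unfolded radon_measure_finite_iff[OF s fk]]
  show ?thesis
    unfolding radon_measure_finite_iff[OF sets_sum_measure fin']
  proof (intro conjI ballI allI impI)
    fix A :: "'a set" and e :: real assume A: "A \<in> sets borel" and "e > 0"
    obtain n where n: "n > 0" "(\<Sum>k. emeasure (m (k + n)) UNIV) \<le> ennreal (e / 2)"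
      using tail[of "e / 2"] \<open>e > 0\<close> by auto
    have "\<forall>k. \<exists>U. open U \<and> A \<subseteq> U \<and> emeasure (m k) (U - A) \<le> ennreal (e / (2 * n))"
      using reg A \<open>e > 0\<close> n(1) by simp
    then obtain U where U: "\<And>k. open (U k)" "\<And>k. A \<subseteq> U k" 
      "\<And>k. emeasure (m k) (U k - A) \<le> ennreal (e / (2 * n))" by metis
    have "emeasure (m k) ((\<Inter>k<n. U k) - A) \<le> ennreal (e / (2 * n))" if "k < n" for k
      using A U that by (intro order_trans[OF mono U(3)]) (auto intro!: sets.Diff)
    moreover have o: "open (\<Inter>k<n. U k)" using U by auto
    ultimately have "emeasure (sum_measure m) ((\<Inter>k<n. U k) - A) \<le> ennreal e"
      using A by (intro small[OF n \<open>e > 0\<close>]) auto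
    then show "\<exists>U. open U \<and> A \<subseteq> U \<and> emeasure (sum_measure m) (U - A) \<le> ennreal e"
      using o U(2) by blast
  next
    fix V :: "'a set" and e :: real assume V: "open V" and "e > 0"
    obtain n where n: "n > 0" "(\<Sum>k. emeasure (m (k + n)) UNIV) \<le> ennreal (e / 2)"
      using tail[of "e / 2"] \<open>e > 0\<close> by auto
    have "\<forall>k. \<exists>K. compact K \<and> K \<subseteq> V \<and> emeasure (m k) (V - K) \<le> ennreal (e / (2 * n))"
      using reg V \<open>e > 0\<close> n(1) by simp
    then obtain K where K: "\<And>k. compact (K k)" "\<And>k. K k \<subseteq> V" 
      "\<And>k. emeasure (m k) (V - K k) \<le> ennreal (e / (2 * n))" by metis
    have "emeasure (m k) (V - (\<Union>k<n. K k)) \<le> ennreal (e / (2 * n))" if "k < n" for k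
      using V K(1)[THEN compact_imp_closed] that
      by (intro order_trans[OF mono K(3)]) (auto intro!: sets.Diff)
    moreover have o: "compact (\<Union>k<n. K k)" using K by auto
    ultimately have "emeasure (sum_measure m) (V - (\<Union>k<n. K k)) \<le> ennreal e"
      using V compact_imp_closed[OF o] by (intro small[OF n \<open>e > 0\<close>]) auto
    then show "\<exists>K. compact K \<and> K \<subseteq> V \<and> emeasure (sum_measure m) (V - K) \<le> ennreal e"
      using o K(2) by (intro exI[of _ "\<Union>k<n. K k"]) auto
  qed
qed

section \<open>Splitting off a largest Radon measure\<close>

lemma radon_measure_sets: "radon_measure m \<Longrightarrow> sets m = sets borel"
  by (simp add: radon_measure_def)

lemma radon_measure_open_SUP:
  "radon_measure m \<Longrightarrow> open U \<Longrightarrow> emeasure m U = (SUP K\<in>{K. compact K \<and> K \<subseteq> U}. emeasure m K)"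
  unfolding radon_measure_def by blast

text \<open>The point is that \<open>\<nu> - m\<close> is monotone: \<open>\<nu>\<close> grows from \<open>F\<close> to \<open>U\<close> by at least \<open>m (U - F)\<close>, because
  \<open>\<nu>\<close> is superadditive, dominates \<open>m\<close> on compact subsets of \<open>U - F\<close>, and \<open>m\<close> is inner regular. The
  regularity of \<open>\<nu> - m\<close> is then inherited from \<open>\<nu>\<close>, using that \<open>m\<close> is monotone.\<close>

lemma DTM_diff_radon:
  fixes \<nu> :: "'a::t2_space set \<Rightarrow> ennreal"
  assumes \<nu>: "\<nu> \<in> DTM" and m: "radon_measure m"
    and le: "\<And>A. A \<in> open_closed_sets \<Longrightarrow> emeasure m A \<le> \<nu> A"
  shows "(\<lambda>A\<in>open_closed_sets. \<nu> A - emeasure m A) \<in> DTM"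
proof (rule DTM_restrictI)
  note s = radon_measure_sets[OF m]
  have fin: "emeasure m A < top" if "A \<in> open_closed_sets" for A
    using le[OF that] DTM_less_top[OF \<nu> that] by (simp add: le_less_trans)
  have split: "\<nu> A = (\<nu> A - emeasure m A) + emeasure m A" if "A \<in> open_closed_sets" for A
    using le[OF that] by (simp add: diff_add_cancel_ennreal)
  show "\<nu> (C \<union> K) - emeasure m (C \<union> K) = \<nu> C - emeasure m C + (\<nu> K - emeasure m K)"
    if C: "compact C" and K: "compact K" and "C \<inter> K = {}" for C K
  proof -
    have "emeasure m (C \<union> K) = emeasure m C + emeasure m K"
      using that s by (intro plus_emeasure[symmetric]) (auto simp: compact_imp_closed)
    moreover have "\<nu> (C \<union> K) = (\<nu> C - emeasure m C + (\<nu> K - emeasure m K)) + (emeasure m C + emeasure m K)"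
      unfolding DTM_compact_Un[OF \<nu> that]
      using split[OF open_closed_setsI(3)[OF C]] split[OF open_closed_setsI(3)[OF K]]
      by (metis add.assoc add.commute)
    ultimately show ?thesis
      using fin[OF open_closed_setsI(3)[OF C]] fin[OF open_closed_setsI(3)[OF K]]
      by (simp add: less_top[symmetric])
  qed
  show "\<nu> F - emeasure m F \<le> \<nu> U - emeasure m U" if F: "closed F" and U: "open U" and "F \<subseteq> U" for F U
  proof -
    have o: "open (U - F)" using F U by auto
    have "\<nu> F + emeasure m (U - F) = (SUP K\<in>{K. compact K \<and> K \<subseteq> U - F}. \<nu> F + emeasure m K)"
      unfolding radon_measure_open_SUP[OF m o]
      by (rule ennreal_SUP_add_right) (auto intro: exI[of _ "{}"])
    also have "\<dots> \<le> \<nu> U"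
    proof (rule SUP_least)
      fix K assume K: "K \<in> {K. compact K \<and> K \<subseteq> U - F}"
      then have "\<nu> F + emeasure m K \<le> \<nu> F + \<nu> K"
        by (intro add_mono le open_closed_setsI(3)) auto
      also have "\<dots> \<le> \<nu> U"
        using K that by (intro DTM_superadditive[OF \<nu>]) auto
      finally show "\<nu> F + emeasure m K \<le> \<nu> U" .
    qed
    finally have *: "\<nu> F + emeasure m (U - F) \<le> \<nu> U" .
    have "emeasure m U = emeasure m F + emeasure m (U - F)"
      using that s by (subst plus_emeasure) (auto simp: Un_absorb1)
    then have "(\<nu> F - emeasure m F) + emeasure m U = \<nu> F + emeasure m (U - F)"
      using split[OF open_closed_setsI(2)[OF F]] by (metis add.assoc)
    then show ?thesis using * by (simp add: ennreal_le_minus_iff)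
  qed
  show "\<nu> U - emeasure m U \<le> (SUP C\<in>{C. compact C \<and> C \<subseteq> U}. \<nu> C - emeasure m C)" (is "_ \<le> ?S")
    if U: "open U" for U
  proof -
    have "\<nu> U \<le> emeasure m U + ?S"
      unfolding DTM_open_SUP[OF \<nu> U]
    proof (rule SUP_least)
      fix C assume C: "C \<in> {C. compact C \<and> C \<subseteq> U}"
      have "\<nu> C = emeasure m C + (\<nu> C - emeasure m C)"
        using C split[of C] by (simp add: open_closed_setsI add.commute)
      also have "\<dots> \<le> emeasure m U + ?S"
        using C U s by (intro add_mono SUP_upper emeasure_mono) auto
      finally show "\<nu> C \<le> emeasure m U + ?S" .
    qed
    then show ?thesis
      using fin[OF open_closed_setsI(1)[OF U]] by (auto simp: ennreal_minus_le_iff)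
  qed
  show "(INF U\<in>{U. open U \<and> F \<subseteq> U}. \<nu> U - emeasure m U) \<le> \<nu> F - emeasure m F" (is "?I \<le> _")
    if F: "closed F" for F
  proof -
    have "?I + emeasure m F \<le> \<nu> F"
      unfolding DTM_closed_INF[OF \<nu> F]
    proof (rule INF_greatest)
      fix U assume U: "U \<in> {U. open U \<and> F \<subseteq> U}"
      have "?I + emeasure m F \<le> (\<nu> U - emeasure m U) + emeasure m U"
        using U s by (intro add_mono INF_lower emeasure_mono) auto
      also have "\<dots> = \<nu> U" using U split[of U] by (simp add: open_closed_setsI)
      finally show "?I + emeasure m F \<le> \<nu> U" .
    qed
    then show ?thesis by (simp add: ennreal_le_minus_iff)
  qed
  show "\<nu> UNIV - emeasure m UNIV < \<infinity>"
    using DTM_finite[OF \<nu>] by (simp add: less_top[symmetric])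
qed

lemma radon_null_measure: "radon_measure (null_measure (borel :: 'a::t2_space measure))"
proof -
  have "sets (null_measure (borel :: 'a measure)) = sets borel" "emeasure (null_measure (borel :: 'a measure)) UNIV < \<infinity>"
    by auto
  from radon_measure_finite_iff[OF this] show ?thesis
    by auto
qed

lemma radon_eq_null_measure:
  assumes "radon_measure m" "emeasure m UNIV = 0"
  shows "m = null_measure borel"
proof (rule measure_eqI)
  show "sets m = sets (null_measure borel)" using radon_measure_sets[OF assms(1)] by simp
  fix A assume "A \<in> sets m"
  then have "emeasure m A \<le> emeasure m UNIV"
    using radon_measure_sets[OF assms(1)] by (intro emeasure_mono) auto
  then show "emeasure m A = emeasure (null_measure borel) A" using assms(2) by simp
qed

text \<open>A set function \<open>h\<close> records what has been split off so far, and \<open>G h\<close> collects the Radon measures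
  that may still be split off. Choosing one with at least half of the largest possible total mass
  leaves, in the limit, nothing more to split off.\<close>

theorem radon_proper_decomposition:
  fixes \<nu> :: "'a::t2_space set \<Rightarrow> ennreal"
  assumes \<nu>: "\<nu> \<in> DTM"
  obtains M q where "radon_measure M" "emeasure M UNIV < \<infinity>" "q \<in> pDTM"
    "\<And>A. A \<in> open_closed_sets \<Longrightarrow> \<nu> A = q A + emeasure M A"
proof -
  define G where "G h = {m. radon_measure m \<and> (\<forall>A\<in>open_closed_sets. h A + emeasure m A \<le> \<nu> A)}"
    for h :: "'a set \<Rightarrow> ennreal"
  have U: "UNIV \<in> open_closed_sets" by (simp add: open_closed_sets_def)
  \<comment> \<open>Half of the supremum of the total masses is exceeded by some member unless the supremum
    is 0, and then the null measure will do.\<close>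
  have choice: "\<exists>m\<in>G h. \<forall>m'\<in>G h. emeasure m' UNIV \<le> 2 * emeasure m UNIV"
    if h: "\<And>A. A \<in> open_closed_sets \<Longrightarrow> h A \<le> \<nu> A" for h
  proof -
    define s where "s = (SUP m\<in>G h. emeasure m UNIV)"
    have "emeasure m UNIV \<le> \<nu> UNIV" if "m \<in> G h" for m
      using that U by (auto simp: G_def intro: order_trans[rotated])
    then have "s \<le> \<nu> UNIV" unfolding s_def by (intro SUP_least)
    then have fin: "s < top" using DTM_finite[OF \<nu>] by (auto intro: le_less_trans)
    have up: "emeasure m UNIV \<le> s" if "m \<in> G h" for m
      unfolding s_def using that by (rule SUP_upper)
    show ?thesis
    proof (cases "s = 0")
      case True
      have "null_measure borel \<in> G h" using h radon_null_measure by (auto simp: G_def)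
      then show ?thesis using up True by (metis le_zero_eq zero_le)
    next
      case False
      then have "s / 2 < s"
        using fin by (cases s) (auto simp: ennreal_divide_numeral ennreal_less_iff)
      then obtain m where m: "m \<in> G h" "s / 2 < emeasure m UNIV"
        unfolding s_def less_SUP_iff by auto
      have "s = 2 * (s / 2)"
        by (simp add: ennreal_times_divide ennreal_mult_divide_eq mult.commute[of 2])
      also have "\<dots> \<le> 2 * emeasure m UNIV" using m(2) by (intro mult_left_mono) auto
      finally show ?thesis using m(1) up by (meson order_trans)
    qed
  qed
  define c where "c h = (SOME m. m \<in> G h \<and> (\<forall>m'\<in>G h. emeasure m' UNIV \<le> 2 * emeasure m UNIV))" for h
  have c: "c h \<in> G h" "\<And>m'. m' \<in> G h \<Longrightarrow> emeasure m' UNIV \<le> 2 * emeasure (c h) UNIV"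
    if "\<And>A. A \<in> open_closed_sets \<Longrightarrow> h A \<le> \<nu> A" for h
    using someI_ex[of "\<lambda>m. m \<in> G h \<and> (\<forall>m'\<in>G h. emeasure m' UNIV \<le> 2 * emeasure m UNIV)"] choice[of h] that
    unfolding c_def[symmetric] by blast+
  define H :: "nat \<Rightarrow> 'a set \<Rightarrow> ennreal" where "H = rec_nat (\<lambda>_. 0) (\<lambda>_ h A. h A + emeasure (c h) A)"
  have H0: "H 0 = (\<lambda>_. 0)" and HS: "H (Suc k) = (\<lambda>A. H k A + emeasure (c (H k)) A)" for k
    by (simp_all add: H_def)
  have Hle: "H k A \<le> \<nu> A" if "A \<in> open_closed_sets" for k A
    using that
  proof (induction k arbitrary: A)
    case (Suc k)
    then have "c (H k) \<in> G (H k)" by (intro c(1))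
    then show ?case using Suc.prems by (simp add: HS G_def)
  qed (simp add: H0)
  define m where "m k = c (H k)" for k
  have mG: "m k \<in> G (H k)" for k unfolding m_def by (rule c(1)[OF Hle])
  then have R: "radon_measure (m k)" for k by (simp add: G_def)
  have Hsum: "H k A = (\<Sum>i<k. emeasure (m i) A)" for k A
    by (induction k) (auto simp: H0 HS m_def)
  have sum_le: "(\<Sum>i. emeasure (m i) A) \<le> \<nu> A" if "A \<in> open_closed_sets" for A
    unfolding suminf_eq_SUP using Hle[OF that] Hsum by (intro SUP_least) auto
  have finsum: "(\<Sum>i. emeasure (m i) UNIV) < \<infinity>"
    using sum_le[OF U] DTM_finite[OF \<nu>] by (rule le_less_trans)
  define M where "M = sum_measure m"
  have RM: "radon_measure M" unfolding M_def using R finsum by (rule radon_sum_measure)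
  have M: "emeasure M A = (\<Sum>i. emeasure (m i) A)" if "A \<in> open_closed_sets" for A
    unfolding M_def using that
    by (intro emeasure_sum_measure radon_measure_sets R open_closed_sets_borel)
  have Mle: "emeasure M A \<le> \<nu> A" if "A \<in> open_closed_sets" for A
    using sum_le M that by simp
  define q where "q = (\<lambda>A\<in>open_closed_sets. \<nu> A - emeasure M A)"
  have q: "q \<in> DTM" unfolding q_def by (rule DTM_diff_radon[OF \<nu> RM Mle])
  have split: "\<nu> A = q A + emeasure M A" if "A \<in> open_closed_sets" for A
    using Mle[OF that] that by (simp add: q_def diff_add_cancel_ennreal)
  have "m' = null_measure borel" if m': "radon_measure m'" "\<forall>A\<in>open_closed_sets. emeasure m' A \<le> q A" for m'
  proof (rule radon_eq_null_measure[OF m'(1)])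
    have "m' \<in> G (H k)" for k
    proof -
      have "H k A + emeasure m' A \<le> \<nu> A" if A: "A \<in> open_closed_sets" for A
      proof -
        have "H k A \<le> emeasure M A"
          unfolding M[OF A] Hsum by (intro sum_le_suminf) auto
        then show ?thesis
          unfolding split[OF A] using m'(2) A by (subst add.commute) (intro add_mono, auto)
      qed
      then show ?thesis using m'(1) by (simp add: G_def)
    qed
    then have "emeasure m' UNIV \<le> 2 * emeasure (m k) UNIV" for k
      unfolding m_def by (intro c(2)[OF Hle])
    \<comment> \<open>A constant series with a finite sum has terms 0.\<close>
    then have "(\<Sum>k. emeasure m' UNIV) \<le> (\<Sum>k. 2 * emeasure (m k) UNIV)"
      by (intro suminf_le) auto
    also have "\<dots> < top" using finsum by (simp add: ennreal_mult_less_top)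
    finally have fin': "(\<Sum>k::nat. emeasure m' UNIV) < top" .
    define r where "r = enn2real (emeasure m' UNIV)"
    have r: "emeasure m' UNIV = ennreal r"
      unfolding r_def using ennreal_suminf_lessD[OF fin'] by (rule ennreal_enn2real[symmetric])
    have "(\<Sum>k::nat. ennreal r) \<noteq> top"
      using fin' unfolding r by (rule less_imp_neq)
    then have "summable (\<lambda>_::nat. r)"
      by (rule summable_suminf_not_top[rotated]) (simp add: r_def)
    then show "emeasure m' UNIV = 0" unfolding r by (simp add: summable_const_iff)
  qed
  then have "q \<in> pDTM"
    using q unfolding pDTM_def proper_dtm_def DTM_def by blast
  moreover have "emeasure M UNIV < \<infinity>" using Mle[OF U] DTM_finite[OF \<nu>] by (rule le_less_trans)
  ultimately show ?thesis by (intro that[OF RM _ _ split])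
qed

section \<open>Adding connected atoms\<close>

text \<open>If a Radon measure \<open>m\<close> lies below the sum, its restriction to the complement of a point \<open>z\<close> of \<open>D\<close>
  lies below \<open>q\<close>, because the open sets \<open>U - {z}\<close> do not contain \<open>D\<close>. As \<open>q\<close> is proper, \<open>m\<close>
  vanishes outside \<open>z\<close>; doing this for two points of \<open>D\<close> shows that \<open>m\<close> is 0.\<close>

lemma pDTM_add_connected_atom:
  fixes q :: "'a::t2_space set \<Rightarrow> ennreal"
  assumes q: "q \<in> pDTM" and a: "a < \<infinity>"
    and D: "compact D" "connected D" and xy: "x \<in> D" "y \<in> D" "x \<noteq> y"
  shows "(\<lambda>A\<in>open_closed_sets. q A + (if D \<subseteq> A then a else 0)) \<in> pDTM" (is "?p \<in> pDTM")
proof -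
  let ?d = "\<lambda>A. if D \<subseteq> A then a else 0"
  have q': "q \<in> DTM" using q by (simp add: pDTM_def)
  have p: "?p \<in> DTM"
  proof (rule DTM_restrictI)
    show "q (C \<union> K) + ?d (C \<union> K) = q C + ?d C + (q K + ?d K)"
      if "compact C" "compact K" "C \<inter> K = {}" for C K
    proof -
      have "D \<subseteq> C \<union> K \<longleftrightarrow> D \<subseteq> C \<or> D \<subseteq> K"
        using connected_closedD[OF D(2), of C K] that by (auto simp: compact_imp_closed)
      moreover have "\<not> (D \<subseteq> C \<and> D \<subseteq> K)" using xy(1) that(3) by auto
      ultimately show ?thesis
        unfolding DTM_compact_Un[OF q' that] by (auto simp: ac_simps)
    qed
    show "q F + ?d F \<le> q U + ?d U" if "closed F" "open U" "F \<subseteq> U" for F U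
      using that by (intro add_mono DTM_mono[OF q'] open_closed_setsI) auto
    show "q U + ?d U \<le> (SUP C\<in>{C. compact C \<and> C \<subseteq> U}. q C + ?d C)" if U: "open U" for U
    proof -
      have "q U + ?d U = (SUP C\<in>{C. compact C \<and> C \<subseteq> U}. q C + ?d U)"
        unfolding DTM_open_SUP[OF q' U]
        by (rule ennreal_SUP_add_left[symmetric]) (auto intro: exI[of _ "{}"])
      also have "\<dots> \<le> (SUP C\<in>{C. compact C \<and> C \<subseteq> U}. q C + ?d C)"
      proof (rule SUP_mono)
        fix C assume C: "C \<in> {C. compact C \<and> C \<subseteq> U}"
        \<comment> \<open>Enlarging \<open>C\<close> by \<open>D\<close> collects the mass \<open>a\<close> and does not decrease \<open>q\<close>.\<close>
        define C' where "C' = (if D \<subseteq> U then C \<union> D else C)"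
        have "q C + ?d U \<le> q C' + ?d C'"
          using C D(1) by (intro add_mono DTM_mono[OF q'] open_closed_setsI) (auto simp: C'_def)
        moreover have "C' \<in> {C. compact C \<and> C \<subseteq> U}" using C D(1) by (auto simp: C'_def)
        ultimately show "\<exists>C'\<in>{C. compact C \<and> C \<subseteq> U}. q C + ?d U \<le> q C' + ?d C'" by blast
      qed
      finally show ?thesis .
    qed
    show "(INF U\<in>{U. open U \<and> F \<subseteq> U}. q U + ?d U) \<le> q F + ?d F" (is "?I \<le> _")
      if F: "closed F" for F
    proof -
      \<comment> \<open>If \<open>F\<close> misses a point of \<open>D\<close>, so does some open set around \<open>F\<close>.\<close>
      obtain V where V: "open V" "F \<subseteq> V" "?d V \<le> ?d F"
      proof (cases "D \<subseteq> F")
        case False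
        then obtain z where "z \<in> D" "z \<notin> F" by auto
        then show ?thesis by (intro that[of "- {z}"]) auto
      qed (auto intro: that[of UNIV])
      show ?thesis
      proof (rule ennreal_le_epsilon)
        fix e :: real assume "0 < e"
        have "q F < q F + ennreal e"
          using DTM_less_top[OF q' open_closed_setsI(2)[OF F]] \<open>0 < e\<close> by (rule less_add_ennreal)
        then obtain U where U: "open U" "F \<subseteq> U" "q U < q F + ennreal e"
          using DTM_closed_INF[OF q' F] unfolding INF_less_iff by (auto simp: INF_less_iff)
        have "?I \<le> q (U \<inter> V) + ?d (U \<inter> V)"
          using U V by (intro INF_lower) auto
        also have "\<dots> \<le> q U + ?d V"
          using U V by (intro add_mono DTM_mono[OF q'] open_closed_setsI) auto
        also have "\<dots> \<le> (q F + ennreal e) + ?d F"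
          using U V by (intro add_mono) auto
        finally show "?I \<le> q F + ?d F + ennreal e" by (simp only: ac_simps)
      qed
    qed
    show "q UNIV + ?d UNIV < \<infinity>"
      using DTM_finite[OF q'] a by simp
  qed
  have "m = null_measure borel" if m: "radon_measure m" and le: "\<forall>A\<in>open_closed_sets. emeasure m A \<le> ?p A" for m
  proof -
    note s = radon_measure_sets[OF m]
    have fin: "emeasure m UNIV < \<infinity>"
      using le[THEN bspec, OF open_closed_setsI(1)[OF open_UNIV]] DTM_finite[OF p] by (rule le_less_trans)
    have zero: "emeasure m (- {z}) = 0" if z: "z \<in> D" for z
    proof -
      define n where "n = density m (indicator (- {z}))"
      have n: "emeasure n A = emeasure m (A - {z})" if "A \<in> sets borel" for A
        using that s unfolding n_def by (subst emeasure_restricted) (auto intro: arg_cong[where f = "emeasure m"])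
      have "radon_measure n"
      proof (rule radon_measure_dominated[OF m fin])
        show "sets n = sets borel" using s by (simp add: n_def)
        show "emeasure n A \<le> emeasure m A" if "A \<in> sets borel" for A
          using that s by (subst n) (auto intro: emeasure_mono)
      qed
      moreover have "emeasure n A \<le> q A" if A: "A \<in> open_closed_sets" for A
      proof -
        have op: "emeasure n U \<le> q U" if U: "open U" for U
        proof -
          have o: "open (U - {z})" using U by auto
          have "emeasure n U \<le> ?p (U - {z})"
            using le n[of U] U o by (auto simp: open_closed_setsI)
          also have "\<dots> = q (U - {z})"
            using z o by (auto simp: open_closed_setsI)
          also have "\<dots> \<le> q U" using o U by (intro DTM_mono[OF q'] open_closed_setsI) auto
          finally show ?thesis .
        qed
        show ?thesis
        proof (cases "open A")
          case False
          then have "closed A" using A by (auto simp: open_closed_sets_def)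
          have "emeasure n A \<le> q U" if "open U" "A \<subseteq> U" for U
          proof -
            have "emeasure n A \<le> emeasure n U"
              using that s by (intro emeasure_mono) (auto simp: n_def)
            then show ?thesis using op[OF \<open>open U\<close>] by (rule order_trans)
          qed
          then show ?thesis
            unfolding DTM_closed_INF[OF q' \<open>closed A\<close>] by (intro INF_greatest) auto
        qed (rule op)
      qed
      ultimately have "n = null_measure borel"
        using q unfolding pDTM_def proper_dtm_def by blast
      then have "emeasure n UNIV = 0" by simp
      then show ?thesis using n[of UNIV] by (simp add: Compl_eq_Diff_UNIV)
    qed
    have "emeasure m UNIV = emeasure m (- {x} \<union> - {y})"
      using xy by (intro arg_cong[where f = "emeasure m"]) auto
    also have "\<dots> \<le> emeasure m (- {x}) + emeasure m (- {y})"
      using s by (intro emeasure_subadditive) auto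
    finally have "emeasure m UNIV = 0" using zero xy by simp
    then show ?thesis by (rule radon_eq_null_measure[OF m])
  qed
  then show ?thesis using p unfolding pDTM_def proper_dtm_def DTM_def by blast
qed

lemma pDTM_add_connected_atoms:
  fixes q :: "'a::t2_space set \<Rightarrow> ennreal"
  assumes q: "q \<in> pDTM" and "finite J"
    and "\<And>j. j \<in> J \<Longrightarrow> a j < \<infinity>"
    and "\<And>j. j \<in> J \<Longrightarrow> compact (D j) \<and> connected (D j) \<and> D j \<noteq> {} \<and> \<not> is_singleton (D j)"
  shows "(\<lambda>A\<in>open_closed_sets. q A + (\<Sum>j\<in>J. if D j \<subseteq> A then a j else 0)) \<in> pDTM"
  using assms(2-4)
proof (induction J rule: finite_induct)
  case empty
  have "q \<in> extensional open_closed_sets"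
    using q by (simp add: pDTM_def DTM_def deficient_topological_measure_def)
  then have "restrict q open_closed_sets = q" by (rule extensional_restrict)
  then show ?case using q by simp
next
  case (insert j J)
  let ?q = "\<lambda>A\<in>open_closed_sets. q A + (\<Sum>j\<in>J. if D j \<subseteq> A then a j else 0)"
  have D: "D j \<noteq> {}" "\<not> is_singleton (D j)" using insert.prems(2)[of j] by auto
  obtain x where x: "x \<in> D j" using D(1) by auto
  then obtain y where xy: "y \<in> D j" "x \<noteq> y"
    using D(2) unfolding is_singleton_def by blast
  have "(\<lambda>A\<in>open_closed_sets. ?q A + (if D j \<subseteq> A then a j else 0)) \<in> pDTM"
    using insert.prems by (intro pDTM_add_connected_atom[OF insert.IH _ _ _ x xy]) auto
  also have "(\<lambda>A\<in>open_closed_sets. ?q A + (if D j \<subseteq> A then a j else 0)) =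
      (\<lambda>A\<in>open_closed_sets. q A + (\<Sum>j\<in>insert j J. if D j \<subseteq> A then a j else 0))"
    using insert.hyps by (intro restrict_ext) (auto simp: ac_simps)
  finally show ?case .
qed

section \<open>The weak topology\<close>

lemma weak_topology_neighbourhood:
  assumes "openin weak_topology W" "\<nu> \<in> W"
  obtains F e where "finite F" "F \<subseteq> C0_plus" "0 < e"
    "\<forall>\<mu>\<in>DTM. (\<forall>f\<in>F. \<bar>dtm_integral \<mu> f - dtm_integral \<nu> f\<bar> < e) \<longrightarrow> \<mu> \<in> W"
proof -
  let ?N = "\<lambda>W. \<exists>F e. finite F \<and> F \<subseteq> C0_plus \<and> 0 < e \<and>
    (\<forall>\<mu>\<in>DTM. (\<forall>f\<in>F. \<bar>dtm_integral \<mu> f - dtm_integral \<nu> f\<bar> < e) \<longrightarrow> \<mu> \<in> W)"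
  have "generate_topology_on {{\<mu>\<in>DTM. dtm_integral \<mu> f \<in> V} | f V. f \<in> C0_plus \<and> open V} W"
    using assms(1) by (simp add: weak_topology_def openin_topology_generated_by_iff)
  then have "?N W" using assms(2)
  proof induction
    case Empty
    then show ?case by simp
  next
    case (Int A B)
    then have "?N A" "?N B" by simp_all
    then obtain F e F' e' where F: "finite F" "F \<subseteq> C0_plus" "0 < e"
        and FA: "\<forall>\<mu>\<in>DTM. (\<forall>f\<in>F. \<bar>dtm_integral \<mu> f - dtm_integral \<nu> f\<bar> < e) \<longrightarrow> \<mu> \<in> A"
      and F': "finite F'" "F' \<subseteq> C0_plus" "0 < e'"
        and FB: "\<forall>\<mu>\<in>DTM. (\<forall>f\<in>F'. \<bar>dtm_integral \<mu> f - dtm_integral \<nu> f\<bar> < e') \<longrightarrow> \<mu> \<in> B"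
      by (elim exE conjE)
    have "\<mu> \<in> A \<inter> B"
      if "\<mu> \<in> DTM" "\<forall>f\<in>F \<union> F'. \<bar>dtm_integral \<mu> f - dtm_integral \<nu> f\<bar> < min e e'" for \<mu>
      using FA[rule_format, OF that(1)] FB[rule_format, OF that(1)] that(2) by simp
    then show ?case using F F' by (intro exI[of _ "F \<union> F'"] exI[of _ "min e e'"]) simp
  next
    case (UN K)
    then obtain k where "k \<in> K" "\<nu> \<in> k" by blast
    then have "?N k" by (rule UN.IH)
    then obtain F e where F: "finite F" "F \<subseteq> C0_plus" "0 < e"
        and Fk: "\<forall>\<mu>\<in>DTM. (\<forall>f\<in>F. \<bar>dtm_integral \<mu> f - dtm_integral \<nu> f\<bar> < e) \<longrightarrow> \<mu> \<in> k"
      by (elim exE conjE)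
    have "\<mu> \<in> \<Union>K"
      if "\<mu> \<in> DTM" "\<forall>f\<in>F. \<bar>dtm_integral \<mu> f - dtm_integral \<nu> f\<bar> < e" for \<mu>
      using Fk[rule_format, OF that(1)] that(2) \<open>k \<in> K\<close> by (intro UnionI) simp_all
    then show ?case using F by (intro exI[of _ F] exI[of _ e]) simp
  next
    case (Basis s)
    then obtain f V where f: "s = {\<mu>\<in>DTM. dtm_integral \<mu> f \<in> V}" "f \<in> C0_plus" "open V" by auto
    then obtain e where "0 < e" "\<And>y. \<bar>y - dtm_integral \<nu> f\<bar> < e \<Longrightarrow> y \<in> V"
      using Basis by (auto simp: open_dist dist_real_def)
    then show ?case using f by (intro exI[of _ "{f}"] exI[of _ e]) auto
  qed
  then obtain F e where "finite F" "F \<subseteq> C0_plus" "0 < e"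
      "\<forall>\<mu>\<in>DTM. (\<forall>f\<in>F. \<bar>dtm_integral \<mu> f - dtm_integral \<nu> f\<bar> < e) \<longrightarrow> \<mu> \<in> W"
    by (elim exE conjE)
  then show ?thesis by (rule that)
qed

text \<open>Below the height \<open>d\<close> the integrand for \<open>\<mu>\<close> is bounded by the total mass; above it, shifting by
  \<open>d\<close> makes it comparable with the integrand for \<open>\<nu>\<close>.\<close>

lemma dtm_integral_le_shift:
  fixes \<mu> \<nu> :: "'a::t2_space set \<Rightarrow> ennreal"
  assumes \<mu>: "\<mu> \<in> DTM" and \<nu>: "\<nu> \<in> DTM" and f: "f \<in> C0_plus" and d: "0 \<le> d"
    and le: "\<And>t. 0 \<le> t \<Longrightarrow> \<mu> (f -` {t + d<..}) \<le> \<nu> (f -` {t<..})"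
  shows "dtm_integral \<mu> f \<le> dtm_integral \<nu> f + d * enn2real (\<mu> UNIV)"
proof -
  obtain b where b: "range f \<subseteq> {0..b}" using C0_plus_bounded[OF f] by blast
  then have b0: "0 \<le> b" by fastforce
  have op: "f -` {t<..} \<in> open_closed_sets" for t
    using f by (intro open_closed_setsI open_vimage) (auto simp: C0_plus_def)
  define g where "g \<mu> t = enn2real (\<mu> (f -` {t<..}))" for \<mu> :: "'a set \<Rightarrow> ennreal" and t
  have g_anti: "g \<rho> t \<le> g \<rho> s" if "\<rho> \<in> DTM" "s \<le> t" for \<rho> s t
    unfolding g_def using that DTM_less_top[OF that(1) op, of s]
    by (intro enn2real_mono DTM_mono op) auto
  \<comment> \<open>The mass of a superlevel set decreases with the level, which gives integrability.\<close>
  have int: "g \<rho> integrable_on {s..t}" if "\<rho> \<in> DTM" for \<rho> s t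
  proof -
    have "mono_on {s..t} (\<lambda>t. - g \<rho> t)" using g_anti[OF that] by (auto simp: mono_on_def)
    from integrable_on_mono_on[OF this] show ?thesis by (simp add: integrable_neg_iff)
  qed
  have "range f \<subseteq> {0..b + d}" using b d by fastforce
  then have "dtm_integral \<mu> f = integral {0..b + d} (g \<mu>)"
    unfolding g_def by (rule dtm_integral_eq[OF \<mu>])
  also have "\<dots> = integral {0..d} (g \<mu>) + integral {d..b + d} (g \<mu>)"
    using b0 d int[OF \<mu>] by (intro Henstock_Kurzweil_Integration.integral_combine[symmetric]) auto
  also have "integral {0..d} (g \<mu>) \<le> integral {0..d} (\<lambda>_. enn2real (\<mu> UNIV))"
  proof (rule integral_le[OF int[OF \<mu>]])
    show "g \<mu> t \<le> enn2real (\<mu> UNIV)" for t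
      unfolding g_def using DTM_finite[OF \<mu>]
      by (intro enn2real_mono DTM_mono[OF \<mu>] op) (auto simp: open_closed_sets_def)
  qed auto
  also have "\<dots> = d * enn2real (\<mu> UNIV)" using d by simp
  also have "integral {d..b + d} (g \<mu>) = integral {0..b} (g \<mu> \<circ> (+) d)"
    by (simp add: integral_shift_Icc_real)
  also have "\<dots> \<le> integral {0..b} (g \<nu>)"
  proof (rule integral_le)
    show "g \<mu> \<circ> (+) d integrable_on {0..b}"
      unfolding integrable_on_shift_Icc_real by (rule int[OF \<mu>])
    show "(g \<mu> \<circ> (+) d) t \<le> g \<nu> t" if "t \<in> {0..b}" for t
      using le[of t] that DTM_less_top[OF \<nu> op, of t] by (auto simp: g_def add.commute intro!: enn2real_mono)
  qed (rule int[OF \<nu>])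
  also have "\<dots> = dtm_integral \<nu> f"
    unfolding g_def by (rule dtm_integral_eq[OF \<nu> b, symmetric])
  finally show ?thesis by simp
qed

section \<open>Density\<close>

text \<open>The cells are indexed by the values of all functions rounded down to multiples of \<open>d\<close>; there are
  finitely many index vectors because the functions are bounded.\<close>

lemma bounded_functions_cells:
  fixes F :: "('a::topological_space \<Rightarrow> real) set"
  assumes "finite F" and "0 < d"
    and meas: "\<And>f. f \<in> F \<Longrightarrow> f \<in> borel_measurable borel"
    and bound: "\<And>f. f \<in> F \<Longrightarrow> \<exists>b. range f \<subseteq> {0..b}"
  obtains r :: "'a \<Rightarrow> ('a \<Rightarrow> real) \<Rightarrow> int"
  where "finite (range r)" "\<And>c. {x. r x = c} \<in> sets borel"
    "\<And>x y f. r x = r y \<Longrightarrow> f \<in> F \<Longrightarrow> \<bar>f x - f y\<bar> < d"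
proof -
  define r :: "'a \<Rightarrow> ('a \<Rightarrow> real) \<Rightarrow> int" where "r x = (\<lambda>f\<in>F. \<lfloor>f x / d\<rfloor>)" for x
  obtain b where b: "\<And>f. f \<in> F \<Longrightarrow> range f \<subseteq> {0..b f}" using bound by metis
  have "range r \<subseteq> (\<Pi>\<^sub>E f\<in>F. {0..\<lfloor>b f / d\<rfloor>})"
  proof (rule image_subsetI)
    fix x
    have "0 \<le> f x" "f x \<le> b f" if "f \<in> F" for f
      using subsetD[OF b[OF that], of "f x"] by simp_all
    then show "r x \<in> (\<Pi>\<^sub>E f\<in>F. {0..\<lfloor>b f / d\<rfloor>})"
      using \<open>0 < d\<close> by (auto simp: r_def intro!: floor_mono divide_right_mono)
  qed
  then have "finite (range r)"
    by (rule finite_subset) (intro finite_PiE \<open>finite F\<close>, auto)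
  moreover have "{x. r x = c} \<in> sets borel" for c
  proof (cases "c \<in> extensional F")
    case True
    then have "{x. r x = c} = {x\<in>space borel. \<forall>f\<in>F. \<lfloor>f x / d\<rfloor> = c f}"
      by (auto simp: r_def fun_eq_iff extensional_def)
    also have "\<dots> \<in> sets borel"
      using \<open>finite F\<close> meas by measurable
    finally show ?thesis .
  next
    case False
    then have "{x. r x = c} = {}" by (auto simp: r_def)
    then show ?thesis by simp
  qed
  moreover have "\<bar>f x - f y\<bar> < d" if "r x = r y" "f \<in> F" for x y f
  proof -
    have "\<lfloor>f x / d\<rfloor> = \<lfloor>f y / d\<rfloor>" using fun_cong[OF that(1), of f] that(2) by (simp add: r_def)
    then have "\<bar>f x / d - f y / d\<bar> < 1" by linarith
    then show ?thesis using \<open>0 < d\<close> by (simp add: diff_divide_distrib[symmetric] abs_divide)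
  qed
  ultimately show ?thesis by (rule that)
qed

theorem theorem47:
  assumes "locally_compact_space (euclidean :: 'a::t2_space topology)"
    and "\<And>U::'a set. open U \<Longrightarrow> U \<noteq> {} \<Longrightarrow>
           \<exists>K\<subseteq>U. compact K \<and> connected K \<and> K \<noteq> {} \<and> \<not> is_singleton K"
  shows "(DTM :: ('a set \<Rightarrow> ennreal) set) \<subseteq> weak_topology closure_of pDTM"
proof
  fix \<nu> :: "'a set \<Rightarrow> ennreal" assume \<nu>: "\<nu> \<in> DTM"
  have "\<exists>\<mu>\<in>pDTM. \<mu> \<in> W" if W: "\<nu> \<in> W" "openin weak_topology W" for W
  proof -
    obtain F e where F: "finite F" "F \<subseteq> C0_plus" "0 < e"
      "\<forall>\<mu>\<in>DTM. (\<forall>f\<in>F. \<bar>dtm_integral \<mu> f - dtm_integral \<nu> f\<bar> < e) \<longrightarrow> \<mu> \<in> W"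
      using weak_topology_neighbourhood[OF W(2,1)] by metis
    obtain M q where M: "radon_measure M" "emeasure M UNIV < \<infinity>" and q: "q \<in> pDTM"
      and split: "\<And>A. A \<in> open_closed_sets \<Longrightarrow> \<nu> A = q A + emeasure M A"
      using radon_proper_decomposition[OF \<nu>] by metis
    note s = radon_measure_sets[OF M(1)]
    define T where "T = enn2real (\<nu> UNIV)"
    \<comment> \<open>The integrals will differ by at most \<open>2 * d * T\<close>, which must be less than \<open>e\<close> even if \<open>T = 0\<close>.\<close>
    define d where "d = e / (2 * (T + 1))"
    have T0: "0 \<le> T" by (simp add: T_def)
    have d: "0 < d" using F(3) T0 by (simp add: d_def)
    have cont: "continuous_on UNIV f" if "f \<in> F" for f using F(2) that by (auto simp: C0_plus_def)
    have meas: "f \<in> borel_measurable borel" if "f \<in> F" for f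
      using cont[OF that] by (rule borel_measurable_continuous_onI)
    have bound: "\<exists>b. range f \<subseteq> {0..b}" if "f \<in> F" for f
      using C0_plus_bounded F(2) that by blast
    obtain r :: "'a \<Rightarrow> ('a \<Rightarrow> real) \<Rightarrow> int" where r: "finite (range r)" "\<And>c. {x. r x = c} \<in> sets borel"
      "\<And>x y f. r x = r y \<Longrightarrow> f \<in> F \<Longrightarrow> \<bar>f x - f y\<bar> < d"
      using bounded_functions_cells[OF F(1) d meas bound] by metis
    \<comment> \<open>Within a cell and within \<open>D\<close> the test functions stay closer than \<open>d\<close> to their values at a
      common point \<open>y\<close> of the cell.\<close>
    have "\<exists>D. compact D \<and> connected D \<and> D \<noteq> {} \<and> \<not> is_singleton D \<and>
        (\<forall>f\<in>F. \<forall>z\<in>D. \<forall>x. r x = c \<longrightarrow> \<bar>f x - f z\<bar> < 2 * d)" if c: "c \<in> range r" for c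
    proof -
      obtain y where y: "c = r y" using c by auto
      define U where "U = (\<Inter>f\<in>F. {z. \<bar>f z - f y\<bar> < d})"
      have "open U"
        unfolding U_def using F(1) cont by (intro open_INT ballI open_Collect_less) (auto intro!: continuous_intros)
      moreover have "y \<in> U" using d by (simp add: U_def)
      ultimately obtain D where D: "D \<subseteq> U" "compact D" "connected D" "D \<noteq> {}" "\<not> is_singleton D"
        using assms(2)[of U] by auto
      have "\<bar>f x - f z\<bar> < 2 * d" if "f \<in> F" "z \<in> D" "r x = c" for f z x
      proof -
        have "\<bar>f z - f y\<bar> < d" using D(1) that by (auto simp: U_def)
        moreover have "\<bar>f x - f y\<bar> < d" using r(3)[of x y f] that y by simp
        ultimately show ?thesis by linarith
      qed
      then show ?thesis using D by blast
    qed
    then obtain D where D: "\<And>c. c \<in> range r \<Longrightarrow> compact (D c) \<and> connected (D c) \<and> D c \<noteq> {} \<and> \<not> is_singleton (D c)"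
      and near: "\<And>c f z x. c \<in> range r \<Longrightarrow> f \<in> F \<Longrightarrow> z \<in> D c \<Longrightarrow> r x = c \<Longrightarrow> \<bar>f x - f z\<bar> < 2 * d"
      by metis
    define a where "a c = emeasure M {x. r x = c}" for c
    define p where "p A = (\<Sum>c\<in>range r. if D c \<subseteq> A then a c else 0)" for A
    define \<mu> where "\<mu> = (\<lambda>A\<in>open_closed_sets. q A + p A)"
    have a: "a c < \<infinity>" for c
      unfolding a_def using s by (intro le_less_trans[OF emeasure_mono M(2)]) auto
    have \<mu>: "\<mu> \<in> pDTM"
      unfolding \<mu>_def p_def using r(1) a D by (intro pDTM_add_connected_atoms[OF q]) auto
    then have \<mu>': "\<mu> \<in> DTM" by (simp add: pDTM_def)
    have cells: "emeasure M A = (\<Sum>c\<in>range r. emeasure M {x\<in>A. r x = c})" if A: "A \<in> sets borel" for A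
    proof -
      have "emeasure M A = emeasure M (\<Union>c\<in>range r. {x\<in>A. r x = c})"
        by (intro arg_cong[where f = "emeasure M"]) auto
      also have "\<dots> = (\<Sum>c\<in>range r. emeasure M {x\<in>A. r x = c})"
      proof (rule sum_emeasure[symmetric])
        show "(\<lambda>c. {x\<in>A. r x = c}) ` range r \<subseteq> sets M"
        proof (rule image_subsetI)
          fix c
          have "{x\<in>A. r x = c} = A \<inter> {x. r x = c}" by auto
          then show "{x\<in>A. r x = c} \<in> sets M" using sets.Int[OF A r(2)[of c]] s by simp
        qed
      qed (auto simp: r(1) disjoint_family_on_def)
      finally show ?thesis .
    qed
    have op: "open (f -` {t<..})" if "f \<in> F" for f t
      using cont[OF that] by (rule open_vimage[OF open_greaterThan])
    \<comment> \<open>A cell that meets the higher superlevel set has its \<open>D\<close> inside the lower one, and a cell whose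
      \<open>D\<close> lies in the higher one is itself contained in the lower one.\<close>
    have Mp: "emeasure M (f -` {t + 2 * d<..}) \<le> p (f -` {t<..})" if f: "f \<in> F" for f t
    proof -
      have "emeasure M {x\<in>f -` {t + 2 * d<..}. r x = c} \<le> (if D c \<subseteq> f -` {t<..} then a c else 0)"
        if c: "c \<in> range r" for c
      proof (cases "D c \<subseteq> f -` {t<..}")
        case True
        then show ?thesis using r(2)[of c] s by (auto simp: a_def intro!: emeasure_mono)
      next
        case False
        then obtain z where z: "z \<in> D c" "f z \<le> t"
          by (auto simp flip: not_less)
        have "f x \<le> t + 2 * d" if "r x = c" for x using near[OF c f z(1) that] z(2) by linarith
        then have empty: "{x\<in>f -` {t + 2 * d<..}. r x = c} = {}" by force
        show ?thesis unfolding empty by simp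
      qed
      then show ?thesis
        unfolding p_def using op[OF f] by (subst cells) (auto intro: sum_mono)
    qed
    have pM: "p (f -` {t + 2 * d<..}) \<le> emeasure M (f -` {t<..})" if f: "f \<in> F" for f t
    proof -
      have "(if D c \<subseteq> f -` {t + 2 * d<..} then a c else 0) \<le> emeasure M {x\<in>f -` {t<..}. r x = c}"
        if c: "c \<in> range r" for c
      proof (cases "D c \<subseteq> f -` {t + 2 * d<..}")
        case True
        obtain z where z: "z \<in> D c" using D[OF c] by auto
        have "t < f x" if "r x = c" for x using near[OF c f z that] True z by auto
        then have whole: "{x\<in>f -` {t<..}. r x = c} = {x. r x = c}" by auto
        show ?thesis unfolding whole by (simp add: a_def)
      qed simp
      then show ?thesis
        unfolding p_def using op[OF f] by (subst cells) (auto intro: sum_mono)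
    qed
    have "p UNIV = emeasure M UNIV"
      by (subst cells) (simp_all add: p_def a_def)
    then have tot: "enn2real (\<mu> UNIV) = T"
      using split[of UNIV] by (simp add: \<mu>_def T_def open_closed_sets_def)
    have "2 * d * T < e"
      using F(3) T0 by (simp add: d_def field_simps)
    have "\<bar>dtm_integral \<mu> f - dtm_integral \<nu> f\<bar> < e" if f: "f \<in> F" for f
    proof -
      have f0: "f \<in> C0_plus" using f F(2) by auto
      have "q (f -` {t + 2 * d<..}) \<le> q (f -` {t<..})" for t
        using q d op[OF f] by (intro DTM_mono open_closed_setsI(1)) (auto simp: pDTM_def)
      note mono = add_mono[OF this pM[OF f]] add_mono[OF this Mp[OF f]]
      have "dtm_integral \<mu> f \<le> dtm_integral \<nu> f + 2 * d * enn2real (\<mu> UNIV)"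
        using d op[OF f] mono(1)
        by (intro dtm_integral_le_shift[OF \<mu>' \<nu> f0]) (simp_all add: \<mu>_def split open_closed_setsI)
      moreover have "dtm_integral \<nu> f \<le> dtm_integral \<mu> f + 2 * d * enn2real (\<nu> UNIV)"
        using d op[OF f] mono(2)
        by (intro dtm_integral_le_shift[OF \<nu> \<mu>' f0]) (simp_all add: \<mu>_def split open_closed_setsI)
      ultimately show ?thesis
        using \<open>2 * d * T < e\<close> unfolding tot T_def[symmetric] by linarith
    qed
    then show ?thesis using F(4)[rule_format, OF \<mu>'] \<mu> by blast
  qed
  then show "\<nu> \<in> weak_topology closure_of pDTM"
    using \<nu> by (auto simp: in_closure_of topspace_weak_topology)
qed

end
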